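(* There exists a connected graph $G$ with $\operatorname{th}_d(G) \leq \operatorname{th}_c(G) - 3$.
   Context: Cops and Robbers on a finite simple graph with $n$ vertices: in round $0$ each of $k$ cops and then the robber choose a vertex; in each later round each cop stays or moves along an edge, then the robber does the same; capture occurs when a cop occupies the robber's vertex. $\operatorname{capt}_k(G)$ is the minimum number of rounds for $k$ cops to capture a robber who evades as long as possible ($\infty$ if $k$ is less than the cop number). A vertex is damaged if the robber occupies it in a round in which capture does not occur; $\operatorname{dmg}_k(G)$ is the minimum number of damaged vertices over games with $k$ cops when the robber maximizes damage. $\operatorname{th}_c(G)=\min_{1\le k\le n}\{k+\operatorname{capt}_k(G)\}$, $\operatorname{th}_d(G)=\min_{1\le k\le n}\{k+\operatorname{dmg}_k(G)\}$. *)

theory Defs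
  imports
    "Graph_Theory.Digraph_Component"
    "HOL-Library.Extended_Nat"
begin

text \<open>
  Finite simple graphs are the symmetric digraphs of the locale \<^locale>\<open>graph\<close>.

  Rounds are numbered from 0. In round 0 the cops are placed and then the robber is placed; in
  every later round the cops move first. The robber's positions at the ends of rounds 0, 1, ... are
  given by an infinite walk; the part of the walk after the capture is irrelevant.
\<close>

definition may_move :: "('a, 'b) pre_digraph \<Rightarrow> 'a \<Rightarrow> 'a \<Rightarrow> bool" where
  "may_move G u v \<longleftrightarrow> u = v \<or> u \<rightarrow>\<^bsub>G\<^esub> v"

text \<open>
  A strategy maps the list of the robber's positions in the rounds so far (in chronological order)
  to the next positions of the cops, cop number \<open>j < k\<close> being placed by the value at \<open>j\<close>. Several
  cops may share a vertex. The earlier positions of the cops are determined by the prefixes of the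
  list, so this is a strategy with full information on the history of the game.
\<close>

definition cop_strategy :: "('a, 'b) pre_digraph \<Rightarrow> nat \<Rightarrow> ('a list \<Rightarrow> nat \<Rightarrow> 'a) \<Rightarrow> bool" where
  "cop_strategy G k \<sigma> \<longleftrightarrow>
     (\<forall>j<k. \<sigma> [] j \<in> verts G) \<and>
     (\<forall>h x. set (h @ [x]) \<subseteq> verts G \<longrightarrow> (\<forall>j<k. may_move G (\<sigma> h j) (\<sigma> (h @ [x]) j)))"

definition robber_walk :: "('a, 'b) pre_digraph \<Rightarrow> (nat \<Rightarrow> 'a) \<Rightarrow> bool" where
  "robber_walk G r \<longleftrightarrow> r 0 \<in> verts G \<and> (\<forall>i. may_move G (r i) (r (Suc i)))"

definition cop_pos :: "('a list \<Rightarrow> nat \<Rightarrow> 'a) \<Rightarrow> (nat \<Rightarrow> 'a) \<Rightarrow> nat \<Rightarrow> nat \<Rightarrow> 'a" where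
  "cop_pos \<sigma> r i j = \<sigma> (map r [0..<i]) j"

text \<open>
  In round \<open>i > 0\<close> a cop may move onto the robber, who is then still at \<open>r (i - 1)\<close>, or the robber
  may move onto a cop.
\<close>

definition capture_in :: "nat \<Rightarrow> ('a list \<Rightarrow> nat \<Rightarrow> 'a) \<Rightarrow> (nat \<Rightarrow> 'a) \<Rightarrow> nat \<Rightarrow> bool" where
  "capture_in k \<sigma> r i \<longleftrightarrow>
     (\<exists>j<k. cop_pos \<sigma> r i j = r i) \<or> (i > 0 \<and> (\<exists>j<k. cop_pos \<sigma> r i j = r (i - 1)))"

text \<open>The infimum of the empty set of extended naturals is \<open>\<infinity>\<close> (no capture).\<close>

definition capture_round :: "nat \<Rightarrow> ('a list \<Rightarrow> nat \<Rightarrow> 'a) \<Rightarrow> (nat \<Rightarrow> 'a) \<Rightarrow> enat" where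
  "capture_round k \<sigma> r = (INF i\<in>{i. capture_in k \<sigma> r i}. enat i)"

text \<open>
  The robber damages the vertices that he occupies in the rounds, including round 0, up to and
  excluding the round of the capture.
\<close>

definition damaged :: "nat \<Rightarrow> ('a list \<Rightarrow> nat \<Rightarrow> 'a) \<Rightarrow> (nat \<Rightarrow> 'a) \<Rightarrow> 'a set" where
  "damaged k \<sigma> r = {r i | i. \<forall>j\<le>i. \<not> capture_in k \<sigma> r j}"

text \<open>
  Once the cops' strategy is fixed, a strategy of the robber amounts to a choice of his walk.
\<close>

definition capt :: "('a, 'b) pre_digraph \<Rightarrow> nat \<Rightarrow> enat" where
  "capt G k =
     (INF \<sigma>\<in>{\<sigma>. cop_strategy G k \<sigma>}. SUP r\<in>{r. robber_walk G r}. capture_round k \<sigma> r)"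

definition dmg :: "('a, 'b) pre_digraph \<Rightarrow> nat \<Rightarrow> enat" where
  "dmg G k =
     (INF \<sigma>\<in>{\<sigma>. cop_strategy G k \<sigma>}. SUP r\<in>{r. robber_walk G r}. enat (card (damaged k \<sigma> r)))"

definition th_c :: "('a, 'b) pre_digraph \<Rightarrow> enat" where
  "th_c G = (MIN k\<in>{1..card (verts G)}. enat k + capt G k)"

definition th_d :: "('a, 'b) pre_digraph \<Rightarrow> enat" where
  "th_d G = (MIN k\<in>{1..card (verts G)}. enat k + dmg G k)"

end

theory Submission
  imports Defs
begin

text \<open>
  Take a path on \<open>n\<close> vertices and glue a 4-cycle, a bead, to each of them. A robber in a bead
  evades a single cop forever by staying opposite to him, so a capture needs two cops at the same
  place, whereas a single cop at the root of the bead stops the damage. Hence \<open>k\<close> evenly spaced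
  cops need about \<open>n / k\<close> rounds for a capture, but they confine the robber within \<open>n / (2 k)\<close>
  rounds. Minimizing over \<open>k\<close> gives about \<open>2 \<surd>n\<close> against \<open>\<surd>(2 n)\<close>; the difference is large enough
  for \<open>n = 201\<close>.
\<close>

section \<open>The necklace as a connected simple graph\<close>

text \<open>Vertex \<open>4 * p + a\<close> with \<open>a < 4\<close> is the \<open>a\<close>-th vertex of bead \<open>p\<close>, and \<open>4 * p\<close> lies on the path.\<close>

definition necklace_adj :: "nat \<Rightarrow> nat \<Rightarrow> bool" where
  "necklace_adj x y \<longleftrightarrow>
     x div 4 = y div 4 \<and> odd (x + y) \<or>
     4 dvd x \<and> 4 dvd y \<and> (x div 4 = Suc (y div 4) \<or> y div 4 = Suc (x div 4))"

definition necklace :: "nat \<Rightarrow> (nat, nat \<times> nat) pre_digraph" where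
  "necklace n = \<lparr>verts = {..<4 * n}, arcs = {(x, y). x < 4 * n \<and> y < 4 * n \<and> necklace_adj x y},
     tail = fst, head = snd\<rparr>"

lemma necklace_adj_sym: "necklace_adj x y \<Longrightarrow> necklace_adj y x"
  unfolding necklace_adj_def by (auto simp: add.commute)

lemma verts_necklace [simp]: "verts (necklace n) = {..<4 * n}"
  by (simp add: necklace_def)

lemma arcs_ends_necklace:
  "arcs_ends (necklace n) = {(x, y). x < 4 * n \<and> y < 4 * n \<and> necklace_adj x y}"
  by (auto simp: necklace_def arcs_ends_conv)

lemma may_move_necklace:
  "may_move (necklace n) x y \<longleftrightarrow> x = y \<or> x < 4 * n \<and> y < 4 * n \<and> necklace_adj x y"
  by (simp add: may_move_def arcs_ends_necklace)

lemma graph_necklace: "graph (necklace n)"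
proof
  have "{(x, y). x < 4 * n \<and> y < 4 * n \<and> necklace_adj x y} \<subseteq> {..<4 * n} \<times> {..<4 * n}"
    by auto
  then show "finite (arcs (necklace n))"
    unfolding necklace_def using finite_subset by fastforce
  show "symmetric (necklace n)"
    unfolding symmetric_def arcs_ends_necklace by (auto intro!: symI necklace_adj_sym)
qed (auto simp: necklace_def arc_to_ends_def necklace_adj_def)

lemma connected_necklace:
  assumes "n > 0"
  shows "connected (necklace n)"
proof -
  interpret graph "necklace n" by (rule graph_necklace)
  have adj: "x \<rightarrow>\<^bsub>necklace n\<^esub> y" if "x < 4 * n" "y < 4 * n" "necklace_adj x y" for x y
    using that by (simp add: arcs_ends_necklace)
  have path: "(4 * p) \<rightarrow>\<^sup>*\<^bsub>necklace n\<^esub> 0" if "p < n" for p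
    using that
  proof (induction p)
    case (Suc p)
    have "(4 * Suc p) \<rightarrow>\<^bsub>necklace n\<^esub> (4 * p)"
      using Suc.prems by (intro adj) (auto simp: necklace_adj_def)
    then show ?case using Suc by (meson Suc_lessD adj_reachable_trans)
  qed (use assms in auto)
  have bead: "x \<rightarrow>\<^sup>*\<^bsub>necklace n\<^esub> (4 * (x div 4))" if "x < 4 * n" for x
  \<comment> \<open>Inside a bead, adjacency means different parity, because the 4-cycle is the
    complete bipartite graph K(2,2). Even vertices therefore reach the root through
    \<open>4 * (x div 4) + 1\<close>.\<close>
  proof (cases "odd x")
    case True
    then show ?thesis using that by (intro reachable_adjI adj) (auto simp: necklace_adj_def)
  next
    case False
    have "x \<rightarrow>\<^bsub>necklace n\<^esub> (4 * (x div 4) + 1)"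
      "(4 * (x div 4) + 1) \<rightarrow>\<^bsub>necklace n\<^esub> (4 * (x div 4))"
      using that False by (intro adj; auto simp: necklace_adj_def)+
    then show ?thesis by (meson adj_reachable_trans reachable_adjI)
  qed
  have to0: "x \<rightarrow>\<^sup>*\<^bsub>necklace n\<^esub> 0" if "x < 4 * n" for x
    using bead[OF that] path[of "x div 4"] that by (auto intro: reachable_trans)
  have "strongly_connected (necklace n)"
  proof
    show "verts (necklace n) \<noteq> {}" using assms by (auto simp: lessThan_empty_iff)
    fix x y assume "x \<in> verts (necklace n)" "y \<in> verts (necklace n)"
    then show "x \<rightarrow>\<^sup>*\<^bsub>necklace n\<^esub> y"
      using to0 symmetric_reachable'[OF to0[of y]] by (auto intro: reachable_trans)
  qed
  then show ?thesis
    unfolding connected_def strongly_connected_def by (auto intro: reachable_mk_symmetricI)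
qed

lemma robber_walk_necklace_less:
  assumes "robber_walk (necklace n) r"
  shows "r i < 4 * n"
  using assms by (induction i) (auto simp: robber_walk_def may_move_necklace, metis)

lemma may_move_cop_pos:
  assumes "cop_strategy G k \<sigma>" "\<And>i. r i \<in> verts G" "j < k"
  shows "may_move G (cop_pos \<sigma> r i j) (cop_pos \<sigma> r (Suc i) j)"
proof -
  have "set (map r [0..<i] @ [r i]) \<subseteq> verts G" using assms(2) by auto
  then show ?thesis using assms(1,3) unfolding cop_strategy_def cop_pos_def by auto
qed

lemma may_move_necklace_div:
  assumes "may_move (necklace n) x y"
  shows "x div 4 \<le> Suc (y div 4)" "y div 4 \<le> Suc (x div 4)"
  using assms by (auto simp: may_move_necklace necklace_adj_def)

text \<open>A cop changes bead by at most one per round, so one that starts more than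
  \<open>t\<close> beads away from a bead stays out of it through round \<open>t\<close>.\<close>

lemma cop_pos_necklace_div:
  assumes "cop_strategy (necklace n) k \<sigma>" "\<And>i. r i < 4 * n" "j < k"
  shows "\<sigma> [] j div 4 \<le> cop_pos \<sigma> r i j div 4 + i \<and> cop_pos \<sigma> r i j div 4 \<le> \<sigma> [] j div 4 + i"
proof (induction i)
  case 0
  show ?case by (simp add: cop_pos_def)
next
  case (Suc i)
  have "may_move (necklace n) (cop_pos \<sigma> r i j) (cop_pos \<sigma> r (Suc i) j)"
    using may_move_cop_pos[OF assms(1) _ assms(3)] assms(2) by simp
  from may_move_necklace_div[OF this] Suc show ?case by linarith
qed

section \<open>Evading one nearby cop\<close>

text \<open>The vertex opposite to the image of \<open>x\<close> under the retraction of the graph onto bead \<open>p\<close>.\<close>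

definition opposite :: "nat \<Rightarrow> nat \<Rightarrow> nat" where
  "opposite p x = (if x div 4 \<noteq> p then 4 * p + 2 else if x mod 4 < 2 then x + 2 else x - 2)"

lemma opposite_div [simp]: "opposite p x div 4 = p"
proof (cases "x div 4 = p")
  case True
  then have "4 * p \<le> x" "x < 4 * p + 4" "x mod 4 = x - 4 * p"
    by (auto simp: minus_mult_div_eq_mod[symmetric])
  then show ?thesis unfolding opposite_def using True by (intro div_nat_eqI) auto
next
  case False
  then show ?thesis unfolding opposite_def by (intro div_nat_eqI) auto
qed

lemma opposite_less: "p < n \<Longrightarrow> opposite p x < 4 * n"
  using opposite_div[of p x] by linarith

lemma even_opposite: "even (opposite p x) \<longleftrightarrow> (x div 4 = p \<longrightarrow> even x)"
proof -
  have "2 \<le> x" if "\<not> x mod 4 < 2" using that by (cases "x < 2") auto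
  then show ?thesis unfolding opposite_def by auto
qed

text \<open>The retraction collapses all roots to \<open>4 * p\<close>, so a cop moving along the
  path leaves the answer of the robber unchanged.\<close>

lemma opposite_cong: "4 dvd x \<Longrightarrow> opposite p x = 4 * p + 2"
  unfolding opposite_def by auto

lemma opposite_outside: "x div 4 \<noteq> p \<Longrightarrow> opposite p x = 4 * p + 2"
  unfolding opposite_def by simp

text \<open>The retraction maps each edge to an edge or a vertex, and the antipodal map is an
  automorphism of the 4-cycle. So the robber can always answer legally.\<close>

lemma may_move_opposite:
  assumes "may_move (necklace n) x y" "p < n"
  shows "may_move (necklace n) (opposite p x) (opposite p y)"
proof (cases "opposite p x = opposite p y")
  case False
  then have "x div 4 = p \<and> y div 4 = p \<and> odd (x + y)"
    using assms opposite_cong[of x p] opposite_cong[of y p]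
      opposite_outside[of x p] opposite_outside[of y p]
    by (cases "y div 4 = p") (auto simp: may_move_necklace necklace_adj_def)
  then show ?thesis
    using assms(2) opposite_less by (auto simp: may_move_necklace necklace_adj_def even_opposite)
qed (simp add: may_move_necklace)

lemma opposite_neq_self: "opposite p x \<noteq> x"
  unfolding opposite_def by (auto; linarith)

text \<open>The mirrored cop is at distance at least 2 from the robber, so his next move is no
  capture.\<close>

lemma opposite_neq:
  assumes "may_move (necklace n) x y"
  shows "opposite p x \<noteq> y"
proof
  assume *: "opposite p x = y"
  then have "x \<noteq> y" "y div 4 = p" by (metis opposite_neq_self, auto)
  then consider "x div 4 = p" "odd (x + y)" | "4 dvd x" "4 dvd y"
    using assms by (auto simp: may_move_necklace necklace_adj_def)
  then show False
  proof cases
    case 1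
    then show False using even_opposite[of p x] * by simp
  next
    case 2
    have "4 dvd 4 * p + 2" using 2 * opposite_cong by metis
    then have "(4::nat) dvd 2" by (subst (asm) dvd_add_right_iff) auto
    then show False by simp
  qed
qed

text \<open>Double counting: each cop is near at most \<open>2 * t + 1\<close> positions, whereas
  two cops near every position require \<open>2 * n\<close> incidences.\<close>

lemma lonely_position:
  fixes c :: "nat \<Rightarrow> nat"
  assumes "k * (2 * t + 1) < 2 * n"
  shows "\<exists>p<n. card {j\<in>{..<k}. c j \<le> p + t \<and> p \<le> c j + t} \<le> 1"
proof (rule ccontr)
  let ?R = "\<lambda>p j. c j \<le> p + t \<and> p \<le> c j + t"
  assume "\<not> ?thesis"
  then have "2 \<le> card {j\<in>{..<k}. ?R p j}" if "p < n" for p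
    using that by (metis Suc_1 not_less_eq_eq)
  then have "(\<Sum>p<n. 2) \<le> (\<Sum>p<n. card {j\<in>{..<k}. ?R p j})"
    by (intro sum_mono) auto
  also have "\<dots> = (\<Sum>j<k. card {p\<in>{..<n}. ?R p j})"
    by (rule sum_multicount_gen) auto
  also have "\<dots> \<le> (\<Sum>j<k. 2 * t + 1)"
  proof (rule sum_mono)
    fix j
    have "card {p\<in>{..<n}. ?R p j} \<le> card {c j - t..c j + t}"
      by (intro card_mono) auto
    then show "card {p\<in>{..<n}. ?R p j} \<le> 2 * t + 1" by simp
  qed
  finally show False using assms by simp
qed

text \<open>The cops react to the robber and he reacts to them. This recursion unwinds the circle
  into the history that arises when he answers each history \<open>h\<close> by
  \<open>f h\<close>.\<close>

primrec replies :: "('a list \<Rightarrow> 'a) \<Rightarrow> nat \<Rightarrow> 'a list" where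
  "replies f 0 = []"
| "replies f (Suc i) = replies f i @ [f (replies f i)]"

lemma map_replies: "map (\<lambda>i. f (replies f i)) [0..<i] = replies f i"
  by (induction i) auto

text \<open>The robber picks a bead with at most one cop starting within \<open>t\<close> beads and
  stays opposite to that cop; no other cop enters the bead through round \<open>t\<close>.\<close>

lemma capt_necklace_ge:
  assumes "k > 0" "k * (2 * t + 1) < 2 * n"
  shows "enat (t + 1) \<le> capt (necklace n) k"
  unfolding capt_def
proof (rule INF_greatest, clarify)
  fix \<sigma> :: "nat list \<Rightarrow> nat \<Rightarrow> nat"
  assume \<sigma>: "cop_strategy (necklace n) k \<sigma>"
  obtain p where p: "p < n"
    and lonely: "card {j\<in>{..<k}. \<sigma> [] j div 4 \<le> p + t \<and> p \<le> \<sigma> [] j div 4 + t} \<le> 1" (is "card ?N \<le> 1")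
    using lonely_position[OF assms(2), where c = "\<lambda>j. \<sigma> [] j div 4"] by blast
  obtain c where c: "c < k" and far: "\<And>j. j < k \<Longrightarrow> j \<noteq> c \<Longrightarrow> j \<notin> ?N"
  proof (cases "?N = {}")
    case True
    \<comment> \<open>With no cop nearby, any cop may be mirrored.\<close>
    then show ?thesis using that[of 0] assms(1) by blast
  next
    case False
    then obtain c where "c \<in> ?N" by blast
    with lonely show ?thesis
      using that[of c] by (auto simp: card_le_Suc0_iff_eq)
  qed
  define f where "f h = opposite p (\<sigma> h c)" for h
  define r where "r i = f (replies f i)" for i
  have r: "r i = opposite p (cop_pos \<sigma> r i c)" for i
    using map_replies[of f i] unfolding r_def f_def cop_pos_def by simp
  have less: "r i < 4 * n" for i
    using opposite_less[OF p] r by metis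
  have cop: "may_move (necklace n) (cop_pos \<sigma> r i j) (cop_pos \<sigma> r (Suc i) j)" if "j < k" for i j
    using may_move_cop_pos[OF \<sigma> _ that] less by simp
  have walk: "robber_walk (necklace n) r"
    unfolding robber_walk_def using less may_move_opposite[OF cop[OF c] p] r by simp
  have "\<not> capture_in k \<sigma> r i" if "i \<le> t" for i
  proof -
    have "cop_pos \<sigma> r i j \<noteq> r i \<and> (i > 0 \<longrightarrow> cop_pos \<sigma> r i j \<noteq> r (i - 1))" if j: "j < k" for j
    proof (cases "j = c")
      case True
      then show ?thesis
        using opposite_neq[OF cop[OF c, of "i - 1"], of p] opposite_neq_self r
        by (metis Suc_diff_1)
    next
      case False
      have "r m div 4 = p" for m using r by simp
      moreover have "cop_pos \<sigma> r i j div 4 \<noteq> p"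
        using far[OF j False] j \<open>i \<le> t\<close> cop_pos_necklace_div[where r = r and i = i, OF \<sigma> less j] by auto
      ultimately show ?thesis by metis
    qed
    then show ?thesis unfolding capture_in_def by auto
  qed
  then have "enat (t + 1) \<le> capture_round k \<sigma> r"
    unfolding capture_round_def by (intro INF_greatest) (auto simp: Suc_le_eq not_le[symmetric])
  also have "\<dots> \<le> (SUP r\<in>{r. robber_walk (necklace n) r}. capture_round k \<sigma> r)"
    using walk by (intro SUP_upper) auto
  finally show "enat (t + 1) \<le> (SUP r\<in>{r. robber_walk (necklace n) r}. capture_round k \<sigma> r)" .
qed

section \<open>Confining the robber to one bead\<close>

definition toward :: "nat \<Rightarrow> nat \<Rightarrow> nat" where
  "toward a b = (if a < b then Suc a else if b < a then a - 1 else a)"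

text \<open>The value is a bead, not a vertex: the cops only use roots. The first list entry is the
  placement of the robber, so cop \<open>j\<close> waits at bead \<open>d * j\<close> in round
  0.\<close>

definition chase :: "nat \<Rightarrow> nat list \<Rightarrow> nat \<Rightarrow> nat" where
  "chase d h j = foldl (\<lambda>a y. toward a (y div 4)) (d * j) h"

lemma cop_strategy_chase:
  assumes "d * K < n"
  shows "cop_strategy (necklace n) (Suc K) (\<lambda>h j. 4 * chase d h j)"
proof -
  have start: "d * j < n" if "j < Suc K" for j
    using assms that by (meson le_less_trans less_Suc_eq_le mult_le_mono2)
  have bound: "chase d h j < n" if "set h \<subseteq> {..<4 * n}" "j < Suc K" for h j
    using that(1)
    by (induction h rule: rev_induct) (use start[OF that(2)] in \<open>auto simp: chase_def toward_def\<close>)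
  have "may_move (necklace n) (4 * chase d h j) (4 * chase d (h @ [x]) j)"
    if "set (h @ [x]) \<subseteq> {..<4 * n}" "j < Suc K" for h x j
    using bound[OF that] bound[of h j] that
    by (auto simp: may_move_necklace necklace_adj_def chase_def toward_def)
  then show ?thesis
    unfolding cop_strategy_def using start by (auto simp: chase_def)
qed

text \<open>
  In a round without capture, the robber is between the cops \<open>j\<close> and \<open>j + 1\<close>; once he is level with
  one of them, this cop stands on the root of his bead, which the robber can leave only through
  the root.
\<close>

lemma squeeze:
  assumes walk: "robber_walk (necklace n) w"
    and j: "j < K" "d * j \<le> w 0 div 4" "w 0 div 4 \<le> d * Suc j"
    and free: "\<And>i'. i' \<le> i \<Longrightarrow> \<not> capture_in (Suc K) (\<lambda>h j. 4 * chase d h j) w i'"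
  defines "L \<equiv> \<lambda>i. chase d (map w [0..<i]) j"
    and "U \<equiv> \<lambda>i. chase d (map w [0..<i]) (Suc j)"
  shows "L i = w i div 4 \<or> U i = w i div 4 \<or>
    L i < w i div 4 \<and> w i div 4 < U i \<and> L i = d * j + i \<and> U i + i = d * Suc j"
    and "i' \<le> i \<Longrightarrow> L i' = w i' div 4 \<or> U i' = w i' div 4 \<Longrightarrow> w i div 4 = w i' div 4"
proof -
  have Suc_L: "L (Suc i) = toward (L i) (w i div 4)" and Suc_U: "U (Suc i) = toward (U i) (w i div 4)" for i
    by (simp_all add: L_def U_def chase_def)
  have avoid: "4 * L i' \<noteq> w i'" "4 * U i' \<noteq> w i'" if "i' \<le> i" for i'
    using free[OF that] j(1) unfolding capture_in_def L_def U_def cop_pos_def by auto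
  have avoid': "4 * L (Suc i') \<noteq> w i'" "4 * U (Suc i') \<noteq> w i'" if "Suc i' \<le> i" for i'
    using free[OF that] j(1) unfolding capture_in_def L_def U_def cop_pos_def by auto
  have step: "w i = w (Suc i) \<or> necklace_adj (w i) (w (Suc i))" for i
    using walk by (auto simp: robber_walk_def may_move_necklace)
  \<comment> \<open>A bead can be left only from its root, and a cop who has just moved to that root
    would have captured the robber there.\<close>
  have stuck: "w (Suc i') div 4 = w i' div 4"
    if "Suc i' \<le> i" "L (Suc i') = w i' div 4 \<or> U (Suc i') = w i' div 4" for i'
    using avoid'[OF that(1)] step[of i'] that(2) by (auto simp: necklace_adj_def)
  have level: "w (Suc i') div 4 = w i' div 4 \<and>
      (L (Suc i') = w (Suc i') div 4 \<or> U (Suc i') = w (Suc i') div 4)"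
    if "Suc i' \<le> i" "L i' = w i' div 4 \<or> U i' = w i' div 4" for i'
    using stuck[OF that(1)] that(2) Suc_L Suc_U by (auto simp: toward_def)
  let ?P = "\<lambda>i. L i = w i div 4 \<or> U i = w i div 4 \<or>
    L i < w i div 4 \<and> w i div 4 < U i \<and> L i = d * j + i \<and> U i + i = d * Suc j"
  have "m \<le> i \<longrightarrow> ?P m" for m
  proof (induction m)
    case 0
    show ?case using j by (auto simp: L_def U_def chase_def)
  next
    case (Suc m)
    show ?case
    proof
      assume le: "Suc m \<le> i"
      then consider "L m = w m div 4 \<or> U m = w m div 4"
        | "L m < w m div 4" "w m div 4 < U m" "L m = d * j + m" "U m + m = d * Suc j"
        using Suc by force
      then show "?P (Suc m)"
      proof cases
        case 1
        with level[OF le] show ?thesis by blast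
      next
        case 2
        \<comment> \<open>Both cops close in by one bead. If one of them becomes level,
          \<open>stuck\<close> holds the robber in his bead; otherwise his own step makes him at
          most level.\<close>
        have LU: "L (Suc m) = Suc (L m)" "U (Suc m) = U m - 1"
          using 2 Suc_L Suc_U by (simp_all add: toward_def)
        have "w m div 4 \<le> Suc (w (Suc m) div 4)" "w (Suc m) div 4 \<le> Suc (w m div 4)"
          using step[of m] by (auto simp: necklace_adj_def)
        then show ?thesis using stuck[OF le] 2 LU by linarith
      qed
    qed
  qed
  then show "?P i" by blast
  show "w i div 4 = w i' div 4" if "i' \<le> i" "L i' = w i' div 4 \<or> U i' = w i' div 4"
  proof -
    have "m \<le> i \<longrightarrow> w m div 4 = w i' div 4 \<and> (L m = w m div 4 \<or> U m = w m div 4)" if "i' \<le> m" for m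
      using that
    proof (induction m rule: dec_induct)
      case base
      show ?case using \<open>L i' = _ \<or> _\<close> by simp
    next
      case (step m)
      then show ?case using level[of m] by auto
    qed
    then show ?thesis using \<open>i' \<le> i\<close> by blast
  qed
qed

text \<open>The \<open>K\<close> gaps of length \<open>2 * s\<close> shrink by two per round until a
  cop is level, which takes at most \<open>s\<close> rounds. Rounds before \<open>s\<close> damage
  at most \<open>s\<close> vertices, later ones only a single bead.\<close>

lemma dmg_necklace_le:
  assumes "K > 0"
  shows "dmg (necklace (2 * s * K + 1)) (Suc K) \<le> enat (s + 4)"
proof -
  let ?n = "2 * s * K + 1" and ?\<sigma> = "\<lambda>h j. 4 * chase (2 * s) h j"
  have \<sigma>: "cop_strategy (necklace ?n) (Suc K) ?\<sigma>"
    by (rule cop_strategy_chase) simp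
  have "card (damaged (Suc K) ?\<sigma> w) \<le> s + 4" if walk: "robber_walk (necklace ?n) w" for w
  proof -
    have "w 0 div 4 \<le> 2 * s * K"
      using robber_walk_necklace_less[OF walk, of 0] by auto
    obtain j where j: "j < K" "2 * s * j \<le> w 0 div 4" "w 0 div 4 \<le> 2 * s * Suc j"
    proof -
      have "\<exists>j<K. 2 * s * j \<le> x \<and> x \<le> 2 * s * Suc j" if "x \<le> 2 * s * K" for x
        using assms that
      proof (induction K)
        case (Suc K)
        then show ?case
          by (cases "x \<le> 2 * s * K \<and> K > 0") (auto intro: less_SucI)
      qed simp
      then show ?thesis using that \<open>w 0 div 4 \<le> 2 * s * K\<close> by blast
    qed
    let ?q = "w s div 4"
    have "damaged (Suc K) ?\<sigma> w \<subseteq> w ` {..<s} \<union> {4 * ?q..<4 * ?q + 4}"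
    proof
      fix x assume "x \<in> damaged (Suc K) ?\<sigma> w"
      then obtain i where x: "x = w i" and free: "\<And>i'. i' \<le> i \<Longrightarrow> \<not> capture_in (Suc K) ?\<sigma> w i'"
        unfolding damaged_def by blast
      show "x \<in> w ` {..<s} \<union> {4 * ?q..<4 * ?q + 4}"
      proof (cases "i < s")
        case False
        \<comment> \<open>Otherwise both cops would be at bead \<open>2 * s * j + s\<close> with the
          robber strictly between them.\<close>
        have "chase (2 * s) (map w [0..<s]) j = ?q \<or> chase (2 * s) (map w [0..<s]) (Suc j) = ?q"
          using squeeze(1)[OF walk j, of s] free False by auto
        then have "w i div 4 = ?q"
          using squeeze(2)[OF walk j free, of i s] False by auto
        then show ?thesis using x by auto
      qed (use x in auto)
    qed
    then have "card (damaged (Suc K) ?\<sigma> w) \<le> card (w ` {..<s} \<union> {4 * ?q..<4 * ?q + 4})"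
      by (intro card_mono) auto
    also have "\<dots> \<le> card (w ` {..<s}) + card {4 * ?q..<4 * ?q + 4}"
      by (rule card_Un_le)
    also have "\<dots> \<le> s + 4"
      using card_image_le[of "{..<s}" w] by simp
    finally show ?thesis .
  qed
  then have "(SUP w\<in>{w. robber_walk (necklace ?n) w}. enat (card (damaged (Suc K) ?\<sigma> w))) \<le> enat (s + 4)"
    by (intro SUP_least) auto
  then show ?thesis
    unfolding dmg_def using \<sigma> by (intro INF_lower2[of ?\<sigma>]) auto
qed

section \<open>The two throttling numbers for 201 beads\<close>

lemma th_d_necklace_le: "th_d (necklace 201) \<le> 25"
proof -
  have "dmg (necklace 201) 11 \<le> 14"
    using dmg_necklace_le[of 10 10] by (simp add: numeral_eq_enat)
  then have "enat 11 + dmg (necklace 201) 11 \<le> enat 11 + 14"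
    by (rule add_left_mono)
  then have "enat 11 + dmg (necklace 201) 11 \<le> 25"
    by (simp add: numeral_eq_enat)
  then show ?thesis
    unfolding th_d_def by (intro order_trans[OF Min.coboundedI]) auto
qed

lemma th_c_necklace_ge: "28 \<le> th_c (necklace 201)"
proof -
  have "28 \<le> enat k + capt (necklace 201) k" if "k \<ge> 1" for k
  proof (cases "k < 28")
    case True
    \<comment> \<open>The choice \<open>t = 27 - k\<close> makes \<open>k + (t + 1)\<close> equal to
      28. The square bounds \<open>k * (55 - 2 * k)\<close> by 55^2 / 8 < 379.\<close>
    have "0 \<le> (55 - 4 * int k)\<^sup>2" by simp
    then have "int k * (55 - 2 * int k) < 402"
      by (simp add: power2_eq_square algebra_simps)
    then have "int (k * (2 * (27 - k) + 1)) < int 402"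
      using True by (simp add: of_nat_diff algebra_simps)
    then have "k * (2 * (27 - k) + 1) < 402" by (simp only: of_nat_less_iff)
    then have "enat (27 - k + 1) \<le> capt (necklace 201) k"
      using that by (intro capt_necklace_ge) auto
    then have "enat k + enat (27 - k + 1) \<le> enat k + capt (necklace 201) k"
      by (rule add_left_mono)
    then show ?thesis using True by (simp add: numeral_eq_enat)
  next
    case False
    then have "28 \<le> enat k" by (simp add: numeral_eq_enat)
    then show ?thesis by (simp add: add_increasing2)
  qed
  then show ?thesis unfolding th_c_def by (subst Min_ge_iff) auto
qed

theorem theorem3p7:
  shows "\<exists>G :: (nat, nat \<times> nat) pre_digraph. graph G \<and> connected G \<and> th_d G + 3 \<le> th_c G"
proof (intro exI conjI)
  show "graph (necklace 201)" "connected (necklace 201)"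
    by (simp_all add: graph_necklace connected_necklace)
  have "th_d (necklace 201) + 3 \<le> 25 + 3"
    by (rule add_right_mono[OF th_d_necklace_le])
  also have "\<dots> \<le> th_c (necklace 201)"
    using th_c_necklace_ge by (simp add: numeral_eq_enat)
  finally show "th_d (necklace 201) + 3 \<le> th_c (necklace 201)" .
qed

end
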